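(* Let workers be organized into a supervision tree with branching factor $k$ and penalty $C>0$. Let $\varepsilon\in(0,1/2)$ and let $\mathcal{F}$ be a distribution of worker effort functions such that workers are proficient on average, i.e. $$\mathrm{E}_{f\sim\mathcal{F}}[\sigma_f]\le\varepsilon,$$ where $\sigma_f$ is the solution of the equation $C=\frac{f'(\sigma_f)k}{2\varepsilon-1}$. If workers are rational, then all interim Bayes–Nash equilibria have the property that every proficient worker plays truthfully.
   Context: Tasks: each task has a correct solution in a set $A$; a worker performs a task by choosing an element of $A$. Effort function: a function $f:(0,1]\to[0,+\infty)$ that is monotonically decreasing, differentiable and strictly convex; a worker pays $f(e)$ per task to have error probability (probability of reporting an incorrect solution) at most $e$. In the present setting it is further assumed that $\lim_{e\to0^+}f(e)=+\infty$, $\lim_{e\to0^+}f'(e)=-\infty$, $\lim_{e\to1/2}f(e)=0$ and $\lim_{e\to1/2}f'(e)=0$; these conditions are imposed so that the equation defining $\sigma_f$ has a unique solution. A worker's strategy is the choice of an error probability $e$; it is truthful if $e<\varepsilon$. A worker with effort function $f$ is proficient if $\sigma_f\le\varepsilon$. Supervision tree of depth $L$: a tree with tasks as leaves (all at level $L-1$), workers as internal nodes, and the supervisor as root (level $0$). Workers at level $L-2$ perform the tasks they are connected to; every node at level $0\le l<L-2$ performs exactly one task in common with each of its children. With branching factor $k$, a worker performs $k$ tasks. The supervisor is truthful, i.e. has error probability less than $\varepsilon$. Each worker is evaluated by its parent on the shared task: it pays the penalty $C$ if its solution differs from the parent's, and $0$ otherwise. If worker $u$ with effort function $f_u$ and error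 probability $e_u$ has parent $w$ with error probability $e_w$, the expected loss of $u$ is $$L(e_u,e_w)=kf_u(e_u)+e_u(1-e_w)C+(1-e_u)e_wC+e_ue_wD,$$ where $D\in[0,C]$ is a constant. Game of incomplete information: worker effort functions are distributed according to $\mathcal{F}$; a worker knows its own effort function but not those of the other workers. In an interim Bayes–Nash equilibrium each worker, knowing its own effort function, minimizes its expected loss, the expectation being taken also over the unknown effort function of its parent.
   Formalization: Effort functions are required to be strictly convex only on (0,1/2] and weakly decreasing on (0,1], since a nonnegative decreasing function with limit 0 at 1/2 vanishes on [1/2,1] and cannot be strictly convex on all of (0,1]. *)

theory Defs
  imports "HOL-Probability.Probability"
begin

definition strictly_convex_on :: "real set \<Rightarrow> (real \<Rightarrow> real) \<Rightarrow> bool" where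
  "strictly_convex_on S f \<longleftrightarrow> convex S \<and>
     (\<forall>x\<in>S. \<forall>y\<in>S. \<forall>t. x \<noteq> y \<and> 0 < t \<and> t < 1 \<longrightarrow>
        f ((1 - t) * x + t * y) < (1 - t) * f x + t * f y)"

(* The derivative is taken relative to the domain {0<..1}; values outside it never matter,
   and at 1 this is the left derivative. *)
definition effort_deriv :: "(real \<Rightarrow> real) \<Rightarrow> real \<Rightarrow> real" where
  "effort_deriv f e = vector_derivative f (at e within {0<..1})"

(* A decreasing nonnegative f tending to 0 at 1/2 vanishes on {1/2..1}, so strict convexity can
   only be required up to 1/2, and monotonicity is the weak one (strictness on {0<..1/2}
   follows from the other conditions). *)
definition effort_function :: "(real \<Rightarrow> real) \<Rightarrow> bool" where
  "effort_function f \<longleftrightarrow>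
     (\<forall>e\<in>{0<..1}. 0 \<le> f e) \<and>
     antimono_on {0<..1} f \<and>
     f differentiable_on {0<..1} \<and>
     strictly_convex_on {0<..1/2} f \<and>
     filterlim f at_top (at_right 0) \<and>
     filterlim (effort_deriv f) at_bot (at_right 0) \<and>
     (f \<longlongrightarrow> 0) (at (1/2)) \<and>
     (effort_deriv f \<longlongrightarrow> 0) (at (1/2))"

definition sigma_eff :: "real \<Rightarrow> nat \<Rightarrow> real \<Rightarrow> (real \<Rightarrow> real) \<Rightarrow> real" where
  "sigma_eff C k \<epsilon> f =
     (THE s. s \<in> {0<..1} \<and> C = effort_deriv f s * real k / (2 * \<epsilon> - 1))"

definition proficient :: "real \<Rightarrow> nat \<Rightarrow> real \<Rightarrow> (real \<Rightarrow> real) \<Rightarrow> bool" where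
  "proficient C k \<epsilon> f \<longleftrightarrow> sigma_eff C k \<epsilon> f \<le> \<epsilon>"

definition truthful :: "real \<Rightarrow> real \<Rightarrow> bool" where
  "truthful \<epsilon> e \<longleftrightarrow> e < \<epsilon>"

(* The parent of the root is irrelevant. *)
record 'n tree =
  nodes :: "'n set"
  root :: 'n
  parent :: "'n \<Rightarrow> 'n"
  level :: "'n \<Rightarrow> nat"
  depth :: nat
  performs :: "'n \<Rightarrow> 'n set"

definition children :: "'n tree \<Rightarrow> 'n \<Rightarrow> 'n set" where
  "children T v = {c \<in> nodes T. c \<noteq> root T \<and> parent T c = v}"

definition tasks :: "'n tree \<Rightarrow> 'n set" where
  "tasks T = {v \<in> nodes T. level T v = depth T - 1}"

definition workers :: "'n tree \<Rightarrow> 'n set" where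
  "workers T = nodes T - {root T} - tasks T"

definition supervision_tree :: "'n tree \<Rightarrow> nat \<Rightarrow> bool" where
  "supervision_tree T k \<longleftrightarrow>
     2 \<le> depth T \<and> 1 \<le> k \<and> finite (nodes T) \<and>
     root T \<in> nodes T \<and> level T (root T) = 0 \<and>
     (\<forall>v\<in>nodes T - {root T}. parent T v \<in> nodes T \<and> level T v = Suc (level T (parent T v))) \<and>
     (\<forall>v\<in>tasks T. children T v = {}) \<and>
     (\<forall>v\<in>nodes T - tasks T. card (children T v) = k) \<and>
     (\<forall>v\<in>nodes T - tasks T. performs T v \<subseteq> tasks T) \<and>
     (\<forall>v\<in>workers T. card (performs T v) = k) \<and>
     (\<forall>v\<in>nodes T. level T v = depth T - 2 \<longrightarrow> performs T v = children T v) \<and>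
     (\<forall>v\<in>nodes T. level T v < depth T - 2 \<longrightarrow>
        (\<forall>c\<in>children T v. card (performs T v \<inter> performs T c) = 1))"

definition loss :: "real \<Rightarrow> real \<Rightarrow> nat \<Rightarrow> (real \<Rightarrow> real) \<Rightarrow> real \<Rightarrow> real \<Rightarrow> real" where
  "loss C D k f e e' =
     real k * f e + e * (1 - e') * C + (1 - e) * e' * C + e * e' * D"

(* A profile maps each worker and each possible own effort function to an error probability. *)
type_synonym 'n profile = "'n \<Rightarrow> (real \<Rightarrow> real) \<Rightarrow> real"

definition strategy_profile ::
  "'n tree \<Rightarrow> (real \<Rightarrow> real) measure \<Rightarrow> 'n profile \<Rightarrow> bool" where
  "strategy_profile T F s \<longleftrightarrow>
     (\<forall>u\<in>workers T. s u \<in> borel_measurable F \<and> (\<forall>f\<in>space F. s u f \<in> {0<..1}))"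

(* e0 is the error probability of the supervisor; every other parent has an unknown
   effort function drawn from F. *)
definition interim_loss ::
  "'n tree \<Rightarrow> (real \<Rightarrow> real) measure \<Rightarrow> real \<Rightarrow> real \<Rightarrow> nat \<Rightarrow> real \<Rightarrow> 'n profile \<Rightarrow>
   'n \<Rightarrow> (real \<Rightarrow> real) \<Rightarrow> real \<Rightarrow> real" where
  "interim_loss T F C D k e0 s u f e =
     (if parent T u = root T then loss C D k f e e0
      else (\<integral>g. loss C D k f e (s (parent T u) g) \<partial>F))"

definition interim_bayes_nash ::
  "'n tree \<Rightarrow> (real \<Rightarrow> real) measure \<Rightarrow> real \<Rightarrow> real \<Rightarrow> nat \<Rightarrow> real \<Rightarrow> 'n profile \<Rightarrow> bool" where
  "interim_bayes_nash T F C D k e0 s \<longleftrightarrow>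
     strategy_profile T F s \<and>
     (\<forall>u\<in>workers T. \<forall>f\<in>space F. \<forall>e\<in>{0<..1}.
        interim_loss T F C D k e0 s u f (s u f) \<le> interim_loss T F C D k e0 s u f e)"

end

theory Submission
  imports Defs
begin

text \<open>
  The expected loss of a worker is affine in its parent's error probability, so only the mean
  \<open>p\<close> of the latter matters, and up to a constant the loss is \<open>k f(e) + m e\<close> with
  \<open>m = (1 - 2p) C + p D\<close>. If \<open>p < \<epsilon>\<close>, then \<open>m > (1 - 2\<epsilon>) C > 0\<close>, so the optimal \<open>e\<close>
  satisfies \<open>f'(e) = - m / k < - (1 - 2\<epsilon>) C / k = f'(\<sigma>\<^sub>f)\<close>, and convexity yields \<open>e < \<sigma>\<^sub>f\<close>.
  Averaging over \<open>f\<close>, the worker's own mean error probability is again less than \<open>\<epsilon>\<close>, and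
  the bound propagates down the tree from the supervisor.
\<close>

lemma strictly_convex_on_imp_convex_on:
  assumes "strictly_convex_on S f"
  shows "convex_on S f"
proof (rule convex_onI)
  show "convex S" using assms by (simp add: strictly_convex_on_def)
next
  fix t x y :: real
  assume "0 < t" "t < 1" "x \<in> S" "y \<in> S"
  then show "f ((1 - t) *\<^sub>R x + t *\<^sub>R y) \<le> (1 - t) * f x + t * f y"
    using assms unfolding strictly_convex_on_def
    by (cases "x = y") (force simp: algebra_simps)+
qed

section \<open>Calculus of a single effort function\<close>

context
  fixes f :: "real \<Rightarrow> real"
  assumes ef: "effort_function f"
begin

lemma effort_deriv_works:
  assumes "e \<in> {0<..1}"
  shows "(f has_real_derivative effort_deriv f e) (at e within {0<..1})"
proof -
  have "f differentiable (at e within {0<..1})"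
    using ef assms by (auto simp: effort_function_def differentiable_on_def)
  then show ?thesis
    by (simp add: effort_deriv_def vector_derivative_works has_real_derivative_iff_has_vector_derivative)
qed

lemma effort_continuous_on: "continuous_on {0<..1} f"
  using ef by (simp add: effort_function_def differentiable_imp_continuous_on)

text \<open>Continuity at 1/2 turns the limit into a value there; monotonicity and nonnegativity
  then squeeze the rest.\<close>

lemma effort_eq_0:
  assumes "1/2 \<le> e" "e \<le> 1"
  shows "f e = 0"
proof -
  have "continuous_on {0<..<1} f"
    by (rule continuous_on_subset[OF effort_continuous_on]) auto
  then have "isCont f (1/2)"
    by (simp add: continuous_on_eq_continuous_at)
  then have "f \<midarrow>1/2\<rightarrow> f (1/2)" by (simp add: isCont_def)
  moreover have "f \<midarrow>1/2\<rightarrow> 0" using ef by (simp add: effort_function_def)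
  ultimately have "f (1/2) = 0" by (rule LIM_unique)
  moreover have "f e \<le> f (1/2)"
    using ef assms by (auto simp: effort_function_def monotone_on_def)
  moreover have "0 \<le> f e" using ef assms by (auto simp: effort_function_def)
  ultimately show ?thesis by simp
qed

text \<open>Derivatives within \<open>{1/2..1}\<close> are unique even at its endpoints, where they
  are one-sided, and \<open>f\<close> is constant on this interval.\<close>

lemma effort_deriv_eq_0:
  assumes "1/2 \<le> e" "e \<le> 1"
  shows "effort_deriv f e = 0"
proof -
  have "(f has_real_derivative effort_deriv f e) (at e within {1/2..1})"
    by (rule DERIV_subset[OF effort_deriv_works]) (use assms in auto)
  moreover have "(f has_real_derivative 0) (at e within {1/2..1})"
    by (rule has_field_derivative_transform_within[OF DERIV_const[of 0], of 1])
       (use assms in \<open>auto simp: effort_eq_0\<close>)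
  moreover have "at e within {1/2..1} \<noteq> bot"
    using assms by (simp add: trivial_limit_within)
  ultimately show ?thesis
    using vector_derivative_unique_within has_real_derivative_iff_has_vector_derivative by blast
qed

lemma effort_above_tangent:
  assumes "x \<in> {0<..<1/2}" "y \<in> {0<..<1/2}"
  shows "effort_deriv f x * (y - x) \<le> f y - f x"
proof (rule convex_on_imp_above_tangent)
  show "convex_on {0<..1/2} f"
    using ef by (simp add: effort_function_def strictly_convex_on_imp_convex_on)
  show "connected {0<..1/2::real}" by (simp add: convex_connected)
  have "{0<..<1/2} \<subseteq> interior {0<..1/2::real}"
    by (rule interior_maximal) auto
  then show "x \<in> interior {0<..1/2}" using assms by blast
  show "y \<in> {0<..1/2}" using assms by auto
  show "(f has_real_derivative effort_deriv f x) (at x within {0<..1/2})"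
    by (rule DERIV_subset[OF effort_deriv_works]) (use assms in auto)
qed

text \<open>Add the tangent inequalities at \<open>x\<close> and at \<open>y\<close>.\<close>

lemma effort_deriv_mono:
  assumes "x \<in> {0<..<1/2}" "y \<in> {0<..<1/2}" "x \<le> y"
  shows "effort_deriv f x \<le> effort_deriv f y"
proof -
  have "effort_deriv f x * (y - x) + effort_deriv f y * (x - y) \<le> 0"
    using effort_above_tangent[of x y] effort_above_tangent[of y x] assms by linarith
  then have "(effort_deriv f x - effort_deriv f y) * (y - x) \<le> 0"
    by (simp add: algebra_simps)
  with \<open>x \<le> y\<close> show ?thesis by (cases "x = y") (auto simp: mult_le_0_iff)
qed

text \<open>Equal slopes at \<open>x\<close> and \<open>y\<close> make both tangent inequalities
  equalities, so the tangent at \<open>x\<close> is the chord; strict convexity puts the midpoint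
  below it.\<close>

lemma effort_deriv_inj_on: "inj_on (effort_deriv f) {0<..<1/2}"
proof (rule inj_onI, rule ccontr)
  fix x y
  assume xy: "x \<in> {0<..<1/2}" "y \<in> {0<..<1/2}" "effort_deriv f x = effort_deriv f y" "x \<noteq> y"
  let ?z = "(1 - 1/2) * x + 1/2 * y"
  have z: "?z \<in> {0<..<1/2}" using xy by auto
  have "f ?z < (1 - 1/2) * f x + 1/2 * f y"
  proof -
    have "strictly_convex_on {0<..1/2} f" using ef by (simp add: effort_function_def)
    moreover have "x \<in> {0<..1/2}" "y \<in> {0<..1/2}" using xy by auto
    ultimately show ?thesis
      using \<open>x \<noteq> y\<close> unfolding strictly_convex_on_def
      by (elim conjE ballE allE[of _ "1/2"] impE) auto
  qed
  moreover have "effort_deriv f x * (y - x) = f y - f x"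
    using effort_above_tangent[of x y] effort_above_tangent[of y x] xy
    by (simp add: algebra_simps)
  moreover have "effort_deriv f x * (?z - x) \<le> f ?z - f x"
    using effort_above_tangent[of x ?z] xy z by blast
  moreover have "effort_deriv f x * (?z - x) = effort_deriv f x * (y - x) / 2"
    by (simp add: field_simps)
  ultimately show False by (simp add: field_simps)
qed

text \<open>The blow-up at 0 confines the search to a compact interval. The minimizer also serves to
  solve the equation for \<sigma>, without an intermediate value argument for the
  derivative.\<close>

lemma linear_cost_minimizer_exists:
  assumes "0 < c"
  obtains x where "x \<in> {0<..1}" "\<And>y. y \<in> {0<..1} \<Longrightarrow> f x + c * x \<le> f y + c * y"
proof -
  have "eventually (\<lambda>x. c < f x) (at_right 0)"
    using ef by (simp add: effort_function_def filterlim_at_top_dense)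
  then obtain d where d: "d > 0" "\<And>x. 0 < x \<Longrightarrow> x < d \<Longrightarrow> c < f x"
    by (auto simp: eventually_at_right_field)
  define d' where "d' = min d 1"
  have d': "0 < d'" "d' \<le> 1" "d' \<le> d" using d by (auto simp: d'_def)
  have "continuous_on {d'..1} (\<lambda>x. f x + c * x)"
    by (intro continuous_intros continuous_on_subset[OF effort_continuous_on]) (use d' in auto)
  then obtain x where x: "x \<in> {d'..1}" "\<And>y. y \<in> {d'..1} \<Longrightarrow> f x + c * x \<le> f y + c * y"
    using continuous_attains_inf[of "{d'..1}" "\<lambda>x. f x + c * x"] d' by auto
  have "f x + c * x \<le> f y + c * y" if y: "y \<in> {0<..1}" for y
  proof (cases "y < d'")
    case True
    \<comment> \<open>The benchmark is the point 1, where effort vanishes and the cost is exactly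
      \<open>c\<close>.\<close>
    have "f x + c * x \<le> c" using x(2)[of 1] d' by (simp add: effort_eq_0)
    also have "c \<le> f y" using d(2)[of y] True y d' by simp
    also have "f y \<le> f y + c * y" using y assms by simp
    finally show ?thesis .
  qed (use x y in auto)
  with x(1) d' show ?thesis by (intro that[of x]) auto
qed

text \<open>Fermat's rule, one side at a time. Left neighbours lie in the domain even at 1 and give
  slope at most \<open>- c < 0\<close>, which forces \<open>x < 1/2\<close>; only then is there room
  on the right for the reverse bound.\<close>

lemma linear_cost_minimizer_deriv:
  assumes "0 < c" "x \<in> {0<..1}" "\<And>y. y \<in> {0<..1} \<Longrightarrow> f x + c * x \<le> f y + c * y"
  shows "x < 1/2" "effort_deriv f x = - c"
proof -
  have der: "((\<lambda>x. f x + c * x) has_real_derivative effort_deriv f x + c) (at x within {0<..1})"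
    using assms by (auto intro!: derivative_eq_intros effort_deriv_works)
  have le: "effort_deriv f x + c \<le> 0"
  proof (rule ccontr)
    assume "\<not> ?thesis"
    then obtain d where d: "d > 0"
      "\<And>h. h > 0 \<Longrightarrow> x - h \<in> {0<..1} \<Longrightarrow> h < d \<Longrightarrow> f (x - h) + c * (x - h) < f x + c * x"
      using has_real_derivative_pos_inc_left[OF der] by force
    define h where "h = min d x / 2"
    have "h > 0" "h < d" "x - h \<in> {0<..1}" using d(1) assms(2) by (auto simp: h_def min_def)
    with d(2)[of h] assms(3)[of "x - h"] show False by simp
  qed
  show x: "x < 1/2"
    using le assms effort_deriv_eq_0[of x] by force
  have "\<not> effort_deriv f x + c < 0"
  proof
    assume "effort_deriv f x + c < 0"
    then obtain d where d: "d > 0"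
      "\<And>h. h > 0 \<Longrightarrow> x + h \<in> {0<..1} \<Longrightarrow> h < d \<Longrightarrow> f (x + h) + c * (x + h) < f x + c * x"
      using has_real_derivative_neg_dec_right[OF der] by force
    define h where "h = min d (1/2) / 2"
    have "h > 0" "h < d" "x + h \<in> {0<..1}" using d(1) assms(2) x by (auto simp: h_def min_def)
    with d(2)[of h] assms(3)[of "x + h"] show False by simp
  qed
  with le show "effort_deriv f x = - c" by simp
qed

text \<open>Makes the definite description meaningful: existence comes from a cost minimizer,
  uniqueness from injectivity of the derivative below 1/2 and its vanishing beyond.\<close>

lemma sigma_eff_works:
  assumes "0 < C" "0 < k" "\<epsilon> < 1/2"
  shows "sigma_eff C k \<epsilon> f \<in> {0<..<1/2}"
    and "effort_deriv f (sigma_eff C k \<epsilon> f) = - ((1 - 2 * \<epsilon>) * C / real k)"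
proof -
  define c where "c = (1 - 2 * \<epsilon>) * C / real k"
  have c: "0 < c" using assms by (simp add: c_def)
  have iff: "C = effort_deriv f s * real k / (2 * \<epsilon> - 1) \<longleftrightarrow> effort_deriv f s = - c" for s
    using assms by (auto simp: c_def field_simps)
  obtain x where x: "x \<in> {0<..<1/2}" "effort_deriv f x = - c"
  proof (rule linear_cost_minimizer_exists[OF c])
    fix x assume x: "x \<in> {0<..1}" "\<And>y. y \<in> {0<..1} \<Longrightarrow> f x + c * x \<le> f y + c * y"
    show thesis
      using linear_cost_minimizer_deriv[OF c x] x(1) by (intro that[of x]) auto
  qed
  have "sigma_eff C k \<epsilon> f = x"
    unfolding sigma_eff_def iff
  proof (rule the_equality)
    show "x \<in> {0<..1} \<and> effort_deriv f x = - c" using x by auto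
  next
    fix s assume s: "s \<in> {0<..1} \<and> effort_deriv f s = - c"
    then have "s < 1/2" using effort_deriv_eq_0[of s] c by force
    with s x show "s = x" using inj_onD[OF effort_deriv_inj_on, of s x] by auto
  qed
  with x show "sigma_eff C k \<epsilon> f \<in> {0<..<1/2}"
    and "effort_deriv f (sigma_eff C k \<epsilon> f) = - ((1 - 2 * \<epsilon>) * C / real k)"
    by (simp_all add: c_def)
qed

lemma best_response_less_sigma_eff:
  assumes "0 < C" "0 \<le> D" "0 < k" "\<epsilon> < 1/2" "0 \<le> p" "p < \<epsilon>"
    and "x \<in> {0<..1}"
    and "\<And>e. e \<in> {0<..1} \<Longrightarrow> loss C D k f x p \<le> loss C D k f e p"
  shows "x < sigma_eff C k \<epsilon> f"
proof -
  define m where "m = (1 - 2 * p) * C + p * D"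
  have loss: "loss C D k f e p = real k * (f e + m / real k * e) + p * C" for e
    using \<open>0 < k\<close> by (simp add: loss_def m_def field_simps)
  have "(1 - 2 * \<epsilon>) * C < (1 - 2 * p) * C" using assms by simp
  also have "\<dots> \<le> m" using assms by (simp add: m_def)
  finally have m: "(1 - 2 * \<epsilon>) * C < m" .
  have "0 < (1 - 2 * \<epsilon>) * C" using assms by simp
  with m have m_pos: "0 < m / real k" using \<open>0 < k\<close> by simp
  have min: "f x + m / real k * x \<le> f y + m / real k * y" if "y \<in> {0<..1}" for y
    using assms(8)[OF that] \<open>0 < k\<close> unfolding loss by simp
  have x: "x < 1/2" "effort_deriv f x = - (m / real k)"
    using linear_cost_minimizer_deriv[OF m_pos \<open>x \<in> {0<..1}\<close>] min by blast+
  note \<sigma> = sigma_eff_works[OF \<open>0 < C\<close> \<open>0 < k\<close> \<open>\<epsilon> < 1/2\<close>]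
  have "effort_deriv f x < effort_deriv f (sigma_eff C k \<epsilon> f)"
    using divide_strict_right_mono[OF m, of "real k"] \<open>0 < k\<close> unfolding x(2) \<sigma>(2) by simp
  \<comment> \<open>By monotonicity of the derivative,
    \<open>sigma_eff C k \<epsilon> f \<le> x\<close> would reverse the inequality just
    shown.\<close>
  then show ?thesis
    using effort_deriv_mono[OF \<sigma>(1), of x] x(1) \<open>x \<in> {0<..1}\<close> by force
qed

end

lemma (in prob_space) expectation_loss:
  assumes "integrable M X"
  shows "expectation (\<lambda>w. loss C D k f e (X w)) = loss C D k f e (expectation X)"
proof -
  \<comment> \<open>Intercept and slope of the loss as an affine function of the parent's error
    probability.\<close>
  define a b where "a = loss C D k f e 0" and "b = loss C D k f e 1 - loss C D k f e 0"
  have loss: "loss C D k f e q = a + q * b" for q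
    by (simp add: loss_def a_def b_def algebra_simps)
  show ?thesis
    using assms unfolding loss by (simp add: prob_space)
qed

text \<open>Supports the induction towards the root; a parent is not a task because tasks have no
  children.\<close>

lemma parent_worker:
  assumes "supervision_tree T k" "u \<in> workers T" "parent T u \<noteq> root T"
  shows "parent T u \<in> workers T" "level T (parent T u) < level T u"
proof -
  have "u \<in> nodes T - {root T}" using assms by (auto simp: workers_def)
  with assms have *: "parent T u \<in> nodes T" "level T u = Suc (level T (parent T u))"
    "u \<in> children T (parent T u)"
    by (auto simp: supervision_tree_def children_def)
  moreover have "parent T u \<notin> tasks T"
    using assms(1) *(3) unfolding supervision_tree_def by blast
  ultimately show "parent T u \<in> workers T" "level T (parent T u) < level T u"
    using assms(3) by (auto simp: workers_def)
qed

theorem theorem5: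
  fixes T :: "'n tree" and k :: nat and C D \<epsilon> e0 :: real
    and F :: "(real \<Rightarrow> real) measure" and s :: "'n profile"
  assumes "supervision_tree T k"
    and "C > 0"
    and "0 \<le> D" and "D \<le> C"
    and "0 < \<epsilon>" and "\<epsilon> < 1/2"
    and "prob_space F"
    and "\<forall>f\<in>space F. effort_function f"
    and "sigma_eff C k \<epsilon> \<in> borel_measurable F"
    and "(\<integral>f. sigma_eff C k \<epsilon> f \<partial>F) \<le> \<epsilon>"
    and "0 \<le> e0" and "truthful \<epsilon> e0"
    and "interim_bayes_nash T F C D k e0 s"
  shows "\<forall>u\<in>workers T. \<forall>f\<in>space F. proficient C k \<epsilon> f \<longrightarrow> truthful \<epsilon> (s u f)"
proof -
  interpret prob_space F by fact
  have k: "0 < k" using assms(1) by (simp add: supervision_tree_def)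
  have s_range: "s u f \<in> {0<..1}" if "u \<in> workers T" "f \<in> space F" for u f
    using assms(13) that unfolding interim_bayes_nash_def strategy_profile_def by blast
  have s_integrable: "integrable F (s u)" if "u \<in> workers T" for u
  proof (rule integrable_const_bound[where B = 1])
    show "AE f in F. norm (s u f) \<le> 1" using s_range[OF that] by force
    show "s u \<in> borel_measurable F"
      using assms(13) that unfolding interim_bayes_nash_def strategy_profile_def by blast
  qed
  have \<sigma>_range: "sigma_eff C k \<epsilon> f \<in> {0<..<1/2}" if "f \<in> space F" for f
    using sigma_eff_works(1) assms that k by blast
  \<comment> \<open>Boundedness ensures that the assumed integral is a genuine mean and not the
    default value 0.\<close>
  have \<sigma>_integrable: "integrable F (sigma_eff C k \<epsilon>)"
    by (rule integrable_const_bound[where B = 1]) (use \<sigma>_range assms(9) in force)+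
  \<comment> \<open>The claim covers all effort functions, not just proficient ones, and compares
    with \<sigma> instead of \<epsilon>, so that it can be averaged over \<open>F\<close> for the
    next level.\<close>
  have less: "\<forall>f\<in>space F. s u f < sigma_eff C k \<epsilon> f" if "u \<in> workers T" for u
    using that
  proof (induction "level T u" arbitrary: u rule: less_induct)
    case less
    define p where "p = (if parent T u = root T then e0 else expectation (s (parent T u)))"
    have p: "0 \<le> p \<and> p < \<epsilon>"
    proof (cases "parent T u = root T")
      case True
      then show ?thesis using assms(11,12) by (simp add: p_def truthful_def)
    next
      case False
      note w = parent_worker[OF assms(1) less.prems False]
      \<comment> \<open>A pointwise strict inequality stays strict after integration because the
        space has positive measure.\<close>
      have "expectation (s (parent T u)) < expectation (sigma_eff C k \<epsilon>)"
        using less.hyps[OF w(2) w(1)] s_integrable[OF w(1)] \<sigma>_integrable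
        by (intro integral_less_AE_space) (auto simp: emeasure_space_1)
      moreover have "0 \<le> expectation (s (parent T u))"
        using s_range[OF w(1)] by (intro integral_nonneg_AE) force
      ultimately show ?thesis using False assms(10) by (simp add: p_def)
    qed
    have loss: "interim_loss T F C D k e0 s u f e = loss C D k f e p" for f e
      using parent_worker(1)[OF assms(1) less.prems] s_integrable
      by (simp add: interim_loss_def p_def expectation_loss)
    show ?case
    proof
      fix f assume f: "f \<in> space F"
      have "loss C D k f (s u f) p \<le> loss C D k f e p" if "e \<in> {0<..1}" for e
        using assms(13) less.prems f that unfolding interim_bayes_nash_def loss[symmetric] by blast
      then show "s u f < sigma_eff C k \<epsilon> f"
        using best_response_less_sigma_eff[of f C D k \<epsilon> p "s u f"] assms k p f
          s_range[OF less.prems f] by blast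
    qed
  qed
  \<comment> \<open>Proficiency supplies the last link, from \<sigma> to \<epsilon>.\<close>
  then show ?thesis
    unfolding proficient_def truthful_def by (meson order_less_le_trans)
qed

end
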